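(* Let $i: H\hookrightarrow G$ be an inclusion of two non-abelian finite simple groups, let $q_H:\tilde H\twoheadrightarrow H$ and $q_G:\tilde G\twoheadrightarrow G$ be their universal central extensions, and let $j:\tilde H\to\tilde G$ be the induced homomorphism on the universal central extensions, i.e. the unique homomorphism with $q_G\circ j=i\circ q_H$. Assume that $G$ does not contain any non-trivial central extension of $H$ as a subgroup (that is, no subgroup of $G$ is isomorphic to a non-trivial central extension of $H$). Then $i:H\hookrightarrow G$ is a localization if and only if $j:\tilde H\to\tilde G$ is a localization.
   Context: A group homomorphism $\varphi:A\to B$ is called a localization if precomposition with $\varphi$ induces a bijection $\varphi^*:\mathrm{Hom}(B,B)\to\mathrm{Hom}(A,B)$, $f\mapsto f\circ\varphi$; equivalently, every homomorphism $A\to B$ factors through $\varphi$ by a unique endomorphism of $B$. For a non-abelian finite simple group $G$, $\mathrm{Mult}(G)=H_2(G;\mathbb{Z})$ is the Schur multiplier and $\mathrm{Mult}(G)\hookrightarrow\tilde G\twoheadrightarrow G$ is the universal central extension of $G$. A central extension of $H$ is a group $E$ with a surjection $E\twoheadrightarrow H$ whose kernel is contained in the center of $E$; it is non-trivial if it is not split, i.e. the surjection $E\twoheadrightarrow H$ admits no section homomorphism. *)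

theory Defs
  imports "HOL-Algebra.Algebra"
begin

definition group_center :: "('a, 'm) monoid_scheme \<Rightarrow> 'a set" where
  "group_center G = {z \<in> carrier G. \<forall>x\<in>carrier G. x \<otimes>\<^bsub>G\<^esub> z = z \<otimes>\<^bsub>G\<^esub> x}"

definition central_extension ::
    "('e, 'm) monoid_scheme \<Rightarrow> ('e \<Rightarrow> 'g) \<Rightarrow> ('g, 'n) monoid_scheme \<Rightarrow> bool" where
  "central_extension E q G \<longleftrightarrow>
     group E \<and> group G \<and> q \<in> epi E G \<and> kernel E G q \<subseteq> group_center E"

definition split_extension ::
    "('e, 'm) monoid_scheme \<Rightarrow> ('e \<Rightarrow> 'g) \<Rightarrow> ('g, 'n) monoid_scheme \<Rightarrow> bool" where
  "split_extension E q G \<longleftrightarrow> (\<exists>s\<in>hom G E. \<forall>x\<in>carrier G. q (s x) = x)"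

text \<open>
  A homomorphism is only determined by its values on the carrier, so the set of homomorphisms
  in the mathematical sense is cut down to one representative per homomorphism by requiring the
  value \<open>undefined\<close> outside the carrier. This matters wherever homomorphisms are counted or
  compared (uniqueness, bijections of Hom sets).
\<close>

definition Hom :: "('a, 'm) monoid_scheme \<Rightarrow> ('b, 'n) monoid_scheme \<Rightarrow> ('a \<Rightarrow> 'b) set" where
  "Hom A B = hom A B \<inter> extensional (carrier A)"

definition localization ::
    "('a, 'm) monoid_scheme \<Rightarrow> ('b, 'n) monoid_scheme \<Rightarrow> ('a \<Rightarrow> 'b) \<Rightarrow> bool" where
  "localization A B \<phi> \<longleftrightarrow>
     \<phi> \<in> hom A B \<and> bij_betw (\<lambda>f. compose (carrier A) f \<phi>) (Hom B B) (Hom A B)"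

text \<open>
  The universal property of a universal central extension ranges over all groups, but a HOL
  formula cannot quantify over types. Here it ranges over the groups on the type \<open>'e list\<close>, where
  \<open>'e\<close> is the element type of \<open>E\<close>. No generality is lost: \<open>'e list\<close> is infinite and at least as
  large as \<open>'e\<close>, and \<open>universal_central_extension_any_type\<close> below derives the universal
  property with respect to central extensions \<open>E'\<close> on an arbitrary type.
\<close>

definition universal_central_extension ::
    "('e, 'm) monoid_scheme \<Rightarrow> ('e \<Rightarrow> 'g) \<Rightarrow> ('g, 'n) monoid_scheme \<Rightarrow> bool" where
  "universal_central_extension E q G \<longleftrightarrow>
     central_extension E q G \<and>
     (\<forall>(E' :: 'e list monoid) q'. central_extension E' q' G \<longrightarrow>
        (\<exists>!f. f \<in> Hom E E' \<and> (\<forall>x\<in>carrier E. q' (f x) = q x)))"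

lemma central_extension_transport:
  fixes E :: "('e, 'm) monoid_scheme" and m :: "'t \<Rightarrow> 'e"
  assumes ce: "central_extension E q G" and K: "subgroup K E"
    and qK: "q ` K = carrier G" and m: "K \<subseteq> range m"
  obtains T :: "'t monoid" and h where
    "h \<in> hom (E\<lparr>carrier := K\<rparr>) T" "m \<in> hom T E" "m ` carrier T \<subseteq> K"
    "\<And>x. x \<in> K \<Longrightarrow> m (h x) = x" "\<And>t. t \<in> carrier T \<Longrightarrow> h (m t) = t"
    "central_extension T (q \<circ> m) G"
proof -
  interpret E: group E using ce by (simp add: central_extension_def)
  have G: "group G" and q: "q \<in> hom E G" using ce by (auto simp: central_extension_def epi_def)
  define h where "h x = (SOME t. m t = x)" for x
  define T where "T = \<lparr>carrier = h ` K, monoid.mult = (\<lambda>s t. h (m s \<otimes>\<^bsub>E\<^esub> m t)), one = h \<one>\<^bsub>E\<^esub>\<rparr>"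
  have mh: "m (h x) = x" if "x \<in> K" for x
    using m that unfolding h_def by (metis (mono_tags, lifting) imageE someI_ex subsetD)
  have KE: "K \<subseteq> carrier E" using K by (simp add: subgroup.subset)
  have hm: "h (m t) = t" if "t \<in> carrier T" for t
    using that by (auto simp: T_def mh)
  have hh: "h \<in> hom (E\<lparr>carrier := K\<rparr>) T"
    by (auto simp: hom_def T_def mh)
  have mm: "m \<in> hom T E"
    using KE by (auto simp: hom_def T_def mh K subgroup.m_closed)
  have mK: "m ` carrier T = K" by (force simp: T_def mh)
  have gK: "group (E\<lparr>carrier := K\<rparr>)" using K E.subgroup_imp_group by blast
  have "h \<in> iso (E\<lparr>carrier := K\<rparr>) T"
    using hh mh by (auto simp: iso_def bij_betw_def T_def intro!: inj_on_inverseI[where g = m])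
  then have "group (T\<lparr>one := h \<one>\<^bsub>E\<lparr>carrier := K\<rparr>\<^esub>\<rparr>)"
    using group.iso_imp_img_group[OF gK] by blast
  then have gT: "group T" by (simp add: T_def)
  have "q \<circ> m \<in> hom T G" using mm q by (rule hom_compose)
  moreover have "(q \<circ> m) ` carrier T = carrier G" using mK qK by (metis image_comp)
  moreover have "kernel T G (q \<circ> m) \<subseteq> group_center T"
  proof
    fix t assume t: "t \<in> kernel T G (q \<circ> m)"
    then have tT: "t \<in> carrier T" by (simp add: kernel_def)
    then have "m t \<in> kernel E G q" using t mK KE by (auto simp: kernel_def)
    then have c: "m t \<in> group_center E" using ce by (auto simp: central_extension_def)
    have "s \<otimes>\<^bsub>T\<^esub> t = t \<otimes>\<^bsub>T\<^esub> s" if "s \<in> carrier T" for s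
    proof -
      have "m s \<in> carrier E" using that mK KE by blast
      then show ?thesis using c by (simp add: group_center_def T_def)
    qed
    then show "t \<in> group_center T" using tT by (simp add: group_center_def)
  qed
  ultimately have "central_extension T (q \<circ> m) G"
    using gT G by (simp add: central_extension_def epi_def)
  then show thesis using that[of h T] hh mm mK mh hm by blast
qed

lemma central_extension_lift_any_type:
  fixes E :: "('e, 'm) monoid_scheme" and E' :: "('c, 'k) monoid_scheme"
  assumes u: "universal_central_extension E q G" and ce: "central_extension E' q' G"
  shows "\<exists>f\<in>hom E E'. \<forall>x\<in>carrier E. q' (f x) = q x"
proof -
  interpret E: group E using u by (simp add: universal_central_extension_def central_extension_def)
  interpret E': group E' using ce by (simp add: central_extension_def)
  interpret G: group G using ce by (simp add: central_extension_def)
  have qi: "q ` carrier E = carrier G" and qh: "q \<in> hom E G"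
    using u by (auto simp: universal_central_extension_def central_extension_def epi_def)
  have q'i: "q' ` carrier E' = carrier G" and q'h: "q' \<in> hom E' G"
    using ce by (auto simp: central_extension_def epi_def)
  have "\<exists>y. y \<in> carrier E' \<and> q' y = q x" if "x \<in> carrier E" for x
    using q'i qi that by (metis imageE imageI)
  then obtain s0 where s0: "\<And>x. x \<in> carrier E \<Longrightarrow> s0 x \<in> carrier E' \<and> q' (s0 x) = q x" by metis
  define s where "s x = (if x = \<one>\<^bsub>E\<^esub> then \<one>\<^bsub>E'\<^esub> else if x \<in> carrier E then s0 x else \<one>\<^bsub>E'\<^esub>)" for x
  have q1: "q \<one>\<^bsub>E\<^esub> = \<one>\<^bsub>G\<^esub>" "q' \<one>\<^bsub>E'\<^esub> = \<one>\<^bsub>G\<^esub>"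
    using qh q'h by (simp_all add: hom_one E.is_group E'.is_group G.is_group)
  have sc: "s x \<in> carrier E'" for x using s0 by (simp add: s_def)
  have qs: "q' (s x) = q x" if "x \<in> carrier E" for x using s0 that q1 by (simp add: s_def)
  have s1: "s \<one>\<^bsub>E\<^esub> = \<one>\<^bsub>E'\<^esub>" by (simp add: s_def)
  define K where "K = generate E' (range s)"
  have K: "subgroup K E'" unfolding K_def by (rule E'.generate_is_subgroup) (use sc in auto)
  have qK: "q' ` K = carrier G"
  proof
    show "q' ` K \<subseteq> carrier G" using K q'i subgroup.subset by blast
    show "carrier G \<subseteq> q' ` K"
    proof
      fix y assume "y \<in> carrier G"
      then obtain x where x: "x \<in> carrier E" "y = q x" using qi by blast
      have "s x \<in> K" unfolding K_def by (rule generate.incl) simp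
      then show "y \<in> q' ` K" using x qs by (metis imageI)
    qed
  qed
  define step where "step p r = s (fst p) \<otimes>\<^bsub>E'\<^esub> inv\<^bsub>E'\<^esub> (s (snd p)) \<otimes>\<^bsub>E'\<^esub> r" for p :: "'e \<times> 'e" and r
  define ev where "ev ps = foldr step ps \<one>\<^bsub>E'\<^esub>" for ps
  have evc: "ev ps \<in> carrier E'" for ps
    by (induction ps) (auto simp: ev_def step_def sc)
  have eva: "ev (ps @ rs) = ev ps \<otimes>\<^bsub>E'\<^esub> ev rs" for ps rs
  proof (induction ps)
    case Nil
    show ?case using evc[of rs] by (simp add: ev_def)
  next
    case (Cons p ps)
    have "ev ((p # ps) @ rs) = step p (ev (ps @ rs))" by (simp add: ev_def)
    also have "\<dots> = step p (ev ps) \<otimes>\<^bsub>E'\<^esub> ev rs"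
      unfolding Cons step_def by (simp add: E'.m_assoc sc evc)
    finally show ?case by (simp add: ev_def)
  qed
  have evs: "k \<in> range ev" if "k \<in> K" for k
    using that unfolding K_def
  proof (induction k rule: generate.induct)
    case one
    have "ev [] = \<one>\<^bsub>E'\<^esub>" by (simp add: ev_def)
    then show ?case by (rule range_eqI[OF sym])
  next
    case (incl k)
    then obtain x where "k = s x" by blast
    then have "ev [(x, \<one>\<^bsub>E\<^esub>)] = k" by (simp add: ev_def step_def s1 sc)
    then show ?case by (rule range_eqI[OF sym])
  next
    case (inv k)
    then obtain x where "k = s x" by blast
    then have "ev [(\<one>\<^bsub>E\<^esub>, x)] = inv\<^bsub>E'\<^esub> k" by (simp add: ev_def step_def s1 sc)
    then show ?case by (rule range_eqI[OF sym])
  next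
    case (eng h1 h2)
    then obtain ps rs where "h1 = ev ps" "h2 = ev rs" by blast
    then have "h1 \<otimes>\<^bsub>E'\<^esub> h2 = ev (ps @ rs)" by (simp add: eva)
    then show ?case by blast
  qed
  define pairs where "pairs xs = map (\<lambda>i. (xs ! (2 * i), xs ! (2 * i + 1))) [0..<length xs div 2]"
    for xs :: "'e list"
  have prs: "\<exists>xs. pairs xs = ps" for ps
  proof -
    have *: "pairs (a # b # xs) = (a, b) # pairs xs" for a b xs
      unfolding pairs_def by (simp add: map_upt_Suc del: upt_Suc)
    have "pairs (concat (map (\<lambda>p. [fst p, snd p]) ps)) = ps"
    proof (induction ps)
      case (Cons p ps)
      show ?case using Cons by (simp add: *)
    qed (simp add: pairs_def)
    then show ?thesis by (rule exI)
  qed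
  have KR: "K \<subseteq> range (ev \<circ> pairs)"
  proof
    fix k assume "k \<in> K"
    then obtain ps where "k = ev ps" using evs by blast
    moreover obtain xs where "pairs xs = ps" using prs by blast
    ultimately have "k = (ev \<circ> pairs) xs" by simp
    then show "k \<in> range (ev \<circ> pairs)" by (rule range_eqI)
  qed
  obtain T :: "'e list monoid" and h where T:
    "ev \<circ> pairs \<in> hom T E'" "central_extension T (q' \<circ> (ev \<circ> pairs)) G"
    using central_extension_transport[OF ce K qK KR] by metis
  then obtain f where "f \<in> Hom E T" "\<forall>x\<in>carrier E. (q' \<circ> (ev \<circ> pairs)) (f x) = q x"
    using u unfolding universal_central_extension_def by blast
  then show ?thesis using T(1)
    by (intro bexI[of _ "(ev \<circ> pairs) \<circ> f"]) (auto simp: Hom_def intro: hom_compose)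
qed

lemma central_extension_lift_unique_any_type:
  fixes E :: "('e, 'm) monoid_scheme" and E' :: "('c, 'k) monoid_scheme"
  assumes u: "universal_central_extension E q G" and ce: "central_extension E' q' G"
    and f: "f \<in> hom E E'" "\<And>x. x \<in> carrier E \<Longrightarrow> q' (f x) = q x"
    and g: "g \<in> hom E E'" "\<And>x. x \<in> carrier E \<Longrightarrow> q' (g x) = q x"
    and x: "x \<in> carrier E"
  shows "f x = g x"
proof -
  interpret E: group E using u by (simp add: universal_central_extension_def central_extension_def)
  interpret E': group E' using ce by (simp add: central_extension_def)
  interpret G: group G using ce by (simp add: central_extension_def)
  have qi: "q ` carrier E = carrier G" and qh: "q \<in> hom E G"
    using u by (auto simp: universal_central_extension_def central_extension_def epi_def)
  have q'i: "q' ` carrier E' = carrier G" and q'h: "q' \<in> hom E' G"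
    using ce by (auto simp: central_extension_def epi_def)
  interpret q': group_hom E' G q' by unfold_locales (rule q'h)
  interpret f: group_hom E E' f by unfold_locales (rule f(1))
  interpret g: group_hom E E' g by unfold_locales (rule g(1))
  define z where "z y = inv\<^bsub>E'\<^esub> (g y) \<otimes>\<^bsub>E'\<^esub> f y" for y
  have zk: "z y \<in> kernel E' G q'" if "y \<in> carrier E" for y
    using that f(2) g(2) by (simp add: kernel_def z_def) (metis E'.inv_closed G.l_inv g.hom_closed q'.hom_closed q'.hom_inv)
  have kc: "kernel E' G q' \<subseteq> group_center E'" using ce by (simp add: central_extension_def)
  have zc: "a \<otimes>\<^bsub>E'\<^esub> z y = z y \<otimes>\<^bsub>E'\<^esub> a" if "y \<in> carrier E" "a \<in> carrier E'" for a y
    using zk[OF that(1)] kc that(2) by (auto simp: group_center_def)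
  have zE: "z y \<in> carrier E'" if "y \<in> carrier E" for y using zk[OF that] by (simp add: kernel_def)
  have fz: "f y = g y \<otimes>\<^bsub>E'\<^esub> z y" if "y \<in> carrier E" for y
    using that by (simp add: z_def E'.m_assoc[symmetric])
  have zh: "z (a \<otimes>\<^bsub>E\<^esub> b) = z a \<otimes>\<^bsub>E'\<^esub> z b" if "a \<in> carrier E" "b \<in> carrier E" for a b
  proof -
    have "z (a \<otimes>\<^bsub>E\<^esub> b) = inv\<^bsub>E'\<^esub> (g b) \<otimes>\<^bsub>E'\<^esub> (z a \<otimes>\<^bsub>E'\<^esub> f b)"
      using that by (simp add: z_def E'.inv_mult_group E'.m_assoc)
    also have "\<dots> = z a \<otimes>\<^bsub>E'\<^esub> z b"
      using that zc[of a "inv\<^bsub>E'\<^esub> (g b)"] zE[of a]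
      by (simp add: z_def[of b] E'.m_assoc[symmetric])
    finally show ?thesis .
  qed
  have z1: "z \<one>\<^bsub>E\<^esub> = \<one>\<^bsub>E'\<^esub>" by (simp add: z_def)
  have zi: "inv\<^bsub>E'\<^esub> (z a) = z (inv\<^bsub>E\<^esub> a)" if "a \<in> carrier E" for a
    by (rule E'.inv_equality) (use that zh[of "inv\<^bsub>E\<^esub> a" a] zE z1 in simp_all)
  define w where "w l = g (hd l) \<otimes>\<^bsub>E'\<^esub> z (hd (tl l))" for l
  define K where "K = {g a \<otimes>\<^bsub>E'\<^esub> z b | a b. a \<in> carrier E \<and> b \<in> carrier E}"
  have KI: "g a \<otimes>\<^bsub>E'\<^esub> z b \<in> K" if "a \<in> carrier E" "b \<in> carrier E" for a b
    using that by (auto simp: K_def)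
  have K: "subgroup K E'"
  proof (rule E'.subgroupI)
    show "K \<subseteq> carrier E'" by (auto simp: K_def zE)
    show "K \<noteq> {}" using KI[OF E.one_closed E.one_closed] by blast
  next
    fix k assume "k \<in> K"
    then obtain a b where ab: "a \<in> carrier E" "b \<in> carrier E" "k = g a \<otimes>\<^bsub>E'\<^esub> z b" by (auto simp: K_def)
    have "inv\<^bsub>E'\<^esub> k = z (inv\<^bsub>E\<^esub> b) \<otimes>\<^bsub>E'\<^esub> g (inv\<^bsub>E\<^esub> a)"
      using ab zE by (simp add: E'.inv_mult_group zi)
    also have "\<dots> = g (inv\<^bsub>E\<^esub> a) \<otimes>\<^bsub>E'\<^esub> z (inv\<^bsub>E\<^esub> b)" using ab by (intro zc[symmetric]) auto
    finally show "inv\<^bsub>E'\<^esub> k \<in> K" using KI[of "inv\<^bsub>E\<^esub> a" "inv\<^bsub>E\<^esub> b"] ab by simp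
  next
    fix k l assume "k \<in> K" "l \<in> K"
    then obtain a b c d where ab: "a \<in> carrier E" "b \<in> carrier E" "k = g a \<otimes>\<^bsub>E'\<^esub> z b"
      "c \<in> carrier E" "d \<in> carrier E" "l = g c \<otimes>\<^bsub>E'\<^esub> z d" by (auto simp: K_def)
    have "k \<otimes>\<^bsub>E'\<^esub> l = g a \<otimes>\<^bsub>E'\<^esub> (z b \<otimes>\<^bsub>E'\<^esub> g c) \<otimes>\<^bsub>E'\<^esub> z d"
      using ab zE by (simp add: E'.m_assoc)
    also have "z b \<otimes>\<^bsub>E'\<^esub> g c = g c \<otimes>\<^bsub>E'\<^esub> z b" using ab by (intro zc[symmetric]) auto
    finally have "k \<otimes>\<^bsub>E'\<^esub> l = g (a \<otimes>\<^bsub>E\<^esub> c) \<otimes>\<^bsub>E'\<^esub> z (b \<otimes>\<^bsub>E\<^esub> d)"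
      using ab zE by (simp add: E'.m_assoc zh)
    then show "k \<otimes>\<^bsub>E'\<^esub> l \<in> K" using KI[of "a \<otimes>\<^bsub>E\<^esub> c" "b \<otimes>\<^bsub>E\<^esub> d"] ab by simp
  qed
  have gK: "g a \<in> K" if "a \<in> carrier E" for a using KI[OF that E.one_closed] that by (simp add: z1)
  have fK: "f a \<in> K" if "a \<in> carrier E" for a using KI[OF that that] that by (simp add: fz)
  have qK: "q' ` K = carrier G"
  proof
    show "q' ` K \<subseteq> carrier G" using K q'i subgroup.subset by blast
    show "carrier G \<subseteq> q' ` K"
    proof
      fix y assume "y \<in> carrier G"
      then obtain x where "x \<in> carrier E" "y = q x" using qi by blast
      then have "y = q' (g x)" "g x \<in> K" using g(2) gK by simp_all
      then show "y \<in> q' ` K" by (rule image_eqI)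
    qed
  qed
  have KR: "K \<subseteq> range w"
  proof
    fix k assume "k \<in> K"
    then obtain a b where "k = g a \<otimes>\<^bsub>E'\<^esub> z b" by (auto simp: K_def)
    then have "k = w [a, b]" by (simp add: w_def)
    then show "k \<in> range w" by blast
  qed
  obtain T :: "'e list monoid" and h where T: "h \<in> hom (E'\<lparr>carrier := K\<rparr>) T"
    "\<And>k. k \<in> K \<Longrightarrow> w (h k) = k" "central_extension T (q' \<circ> w) G"
    using central_extension_transport[OF ce K qK KR] by metis
  have lift: "restrict (h \<circ> p) (carrier E) \<in> Hom E T \<and>
      (\<forall>y\<in>carrier E. (q' \<circ> w) (restrict (h \<circ> p) (carrier E) y) = q y)"
    if "p \<in> hom E E'" "\<And>y. y \<in> carrier E \<Longrightarrow> q' (p y) = q y" "\<And>y. y \<in> carrier E \<Longrightarrow> p y \<in> K" for p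
  proof -
    have "p \<in> hom E (E'\<lparr>carrier := K\<rparr>)" using that by (auto simp: hom_def)
    then have "h \<circ> p \<in> hom E T" using T(1) by (rule hom_compose)
    then show ?thesis using that T(2) by (auto simp: Hom_def hom_def)
  qed
  have "restrict (h \<circ> f) (carrier E) = restrict (h \<circ> g) (carrier E)"
    using u T(3) lift[OF f fK] lift[OF g gK] unfolding universal_central_extension_def by blast
  then have "h (f x) = h (g x)" using x by (metis comp_apply restrict_apply')
  then show ?thesis using T(2) fK gK x by metis
qed

theorem universal_central_extension_any_type:
  fixes E :: "('e, 'm) monoid_scheme" and E' :: "('c, 'k) monoid_scheme"
  assumes u: "universal_central_extension E q G" and ce: "central_extension E' q' G"
  shows "\<exists>!f. f \<in> Hom E E' \<and> (\<forall>x\<in>carrier E. q' (f x) = q x)"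
proof -
  interpret E: group E using u by (simp add: universal_central_extension_def central_extension_def)
  obtain f where f: "f \<in> hom E E'" "\<forall>x\<in>carrier E. q' (f x) = q x"
    using central_extension_lift_any_type[OF u ce] by blast
  show ?thesis
  proof (rule ex1I[of _ "restrict f (carrier E)"])
    show "restrict f (carrier E) \<in> Hom E E' \<and> (\<forall>x\<in>carrier E. q' (restrict f (carrier E) x) = q x)"
      using f by (auto simp: Hom_def hom_def)
  next
    fix g assume g: "g \<in> Hom E E' \<and> (\<forall>x\<in>carrier E. q' (g x) = q x)"
    show "g = restrict f (carrier E)"
    proof (rule extensionalityI[of _ "carrier E"])
      show "g x = restrict f (carrier E) x" if "x \<in> carrier E" for x
        using central_extension_lift_unique_any_type[OF u ce, of g f x] f g that by (simp add: Hom_def)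
    qed (use g in \<open>auto simp: Hom_def\<close>)
  qed
qed

end

theory Submission
  imports Defs
begin

text \<open>
  Write \<open>q\<^sub>G : Gt \<rightarrow> G\<close> for the universal central extension of \<open>G\<close>. The idea is that both
  conditions compare the same sets of homomorphisms: composition with \<open>q\<^sub>G\<close> and \<open>q\<^sub>H\<close> identifies
  \<open>Hom(Ht, Gt)\<close> with \<open>Hom(H, G)\<close> and \<open>Hom(Gt, Gt)\<close> with \<open>Hom(G, G)\<close>, and under these bijections
  precomposition with \<open>j\<close> becomes precomposition with \<open>i\<close>.

  Both bijections are instances of \<open>ex_bij_betw_Hom_lift\<close>, for a universal central extension
  \<open>q : E \<rightarrow> S\<close> of a simple group \<open>S\<close>. A homomorphism \<open>k : S \<rightarrow> G\<close> lifts to \<open>E \<rightarrow> Gt\<close>, because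
  the fibre product of \<open>k\<close> and \<open>q\<^sub>G\<close> is a central extension of \<open>S\<close> (\<open>ex_lift_along_hom\<close>).
  The lift is unique, because \<open>E\<close> is perfect and two lifts differ by a homomorphism into the
  abelian group \<open>ker q\<^sub>G\<close> (\<open>hom_to_central_extension_unique\<close>). Conversely, a homomorphism
  \<open>h : E \<rightarrow> G\<close> is trivial or satisfies \<open>ker h \<subseteq> ker q\<close> (\<open>hom_trivial_or_kernel_subset\<close>), so
  that it descends to \<open>S\<close> once \<open>ker h \<subseteq> ker q\<close> implies \<open>ker q \<subseteq> ker h\<close>. For \<open>S = G\<close> this is a
  matter of counting (\<open>kernel_subset_of_finite\<close>). For \<open>S = H\<close> the image \<open>h(Ht)\<close> is a central
  extension of \<open>H\<close> inside \<open>G\<close>, hence split by hypothesis, and uniqueness of lifts shows that \<open>h\<close>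
  is a section composed with \<open>q\<^sub>H\<close> (\<open>kernel_subset_of_no_central_extension\<close>).
\<close>

section \<open>Preliminaries on homomorphisms and central extensions\<close>

lemma hom_factor_epi:
  assumes "group E" "group A" "group B" "p \<in> epi E A" "h \<in> hom E B"
    and ker: "kernel E A p \<subseteq> kernel E B h"
  obtains k where "k \<in> hom A B" "\<And>x. x \<in> carrier E \<Longrightarrow> k (p x) = h x"
proof -
  interpret p: group_hom E A p
    using assms by (auto simp: group_hom_def group_hom_axioms_def epi_def)
  interpret h: group_hom E B h
    using assms by (auto simp: group_hom_def group_hom_axioms_def)
  have surj: "p ` carrier E = carrier A" using assms(4) by (simp add: epi_def)
  have eq: "h x = h y" if "x \<in> carrier E" "y \<in> carrier E" "p x = p y" for x y
  proof -
    have "x \<otimes>\<^bsub>E\<^esub> inv\<^bsub>E\<^esub> y \<in> kernel E A p" using that by (simp add: kernel_def)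
    then have "h (x \<otimes>\<^bsub>E\<^esub> inv\<^bsub>E\<^esub> y) = \<one>\<^bsub>B\<^esub>" using ker by (auto simp: kernel_def)
    then have "h x \<otimes>\<^bsub>B\<^esub> inv\<^bsub>B\<^esub> (h y) = \<one>\<^bsub>B\<^esub>" using that by simp
    then show ?thesis using that by (metis h.H.inv_equality h.H.inv_inv h.hom_closed h.H.inv_closed)
  qed
  define k where "k a = h (inv_into (carrier E) p a)" for a
  have kp: "k (p x) = h x" if "x \<in> carrier E" for x
    unfolding k_def using that by (intro eq) (auto simp: inv_into_into f_inv_into_f)
  have "k \<in> hom A B"
  proof (rule homI)
    fix a assume "a \<in> carrier A"
    then obtain x where "x \<in> carrier E" "a = p x" using surj by blast
    then show "k a \<in> carrier B" by (simp add: kp)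
  next
    fix a b assume "a \<in> carrier A" "b \<in> carrier A"
    then obtain x y where xy: "x \<in> carrier E" "a = p x" "y \<in> carrier E" "b = p y"
      using surj by blast
    then have "k (a \<otimes>\<^bsub>A\<^esub> b) = k (p (x \<otimes>\<^bsub>E\<^esub> y))" by simp
    also have "\<dots> = k a \<otimes>\<^bsub>B\<^esub> k b" using xy kp[of "x \<otimes>\<^bsub>E\<^esub> y"] by (simp add: kp)
    finally show "k (a \<otimes>\<^bsub>A\<^esub> b) = k a \<otimes>\<^bsub>B\<^esub> k b" .
  qed
  then show thesis using kp that by blast
qed

lemma compose_in_Hom:
  assumes "group A" "m \<in> hom A B" "f \<in> Hom B C"
  shows "compose (carrier A) f m \<in> Hom A C"
proof -
  interpret A: group A by fact
  have "f \<circ> m \<in> hom A C" using assms by (auto simp: Hom_def intro: hom_compose)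
  then show ?thesis by (auto simp: Hom_def hom_def compose_def Pi_iff)
qed

lemma central_extension_group_hom:
  assumes "central_extension E q S"
  shows "group_hom E S q" "q ` carrier E = carrier S"
  using assms by (auto simp: central_extension_def epi_def group_hom_def group_hom_axioms_def)

lemma central_extension_kernel_commute:
  assumes "central_extension E q S" "z \<in> kernel E S q" "x \<in> carrier E"
  shows "x \<otimes>\<^bsub>E\<^esub> z = z \<otimes>\<^bsub>E\<^esub> x"
  using assms by (auto simp: central_extension_def group_center_def)

lemma universal_central_extension_imp_central_extension:
  "universal_central_extension E q S \<Longrightarrow> central_extension E q S"
  by (simp add: universal_central_extension_def)

section \<open>Universal central extensions are perfect\<close>

text \<open>
  This is perfectness of \<open>E\<close>: the trivial central extension \<open>E \<times> A \<rightarrow> S\<close> admits the two lifts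
  \<open>x \<mapsto> (x, 1)\<close> and \<open>x \<mapsto> (x, c x)\<close> of \<open>q\<close>.
\<close>

lemma hom_to_abelian_trivial:
  assumes u: "universal_central_extension E q S" and A: "comm_group A"
    and c: "c \<in> hom E A" and x: "x \<in> carrier E"
  shows "c x = \<one>\<^bsub>A\<^esub>"
proof -
  note ce = universal_central_extension_imp_central_extension[OF u]
  interpret q: group_hom E S q by (rule central_extension_group_hom[OF ce])
  interpret A: comm_group A by (rule A)
  have ceEA: "central_extension (E \<times>\<times> A) (q \<circ> fst) S"
    unfolding central_extension_def
  proof (intro conjI)
    show "group (E \<times>\<times> A)" by (rule DirProd_group) unfold_locales
    show "group S" by unfold_locales
    have "fst ` (carrier E \<times> carrier A) = carrier E" using A.one_closed by auto
    then have "(q \<circ> fst) ` (carrier E \<times> carrier A) = carrier S"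
      using central_extension_group_hom(2)[OF ce] by (simp only: image_comp[symmetric])
    moreover have "q \<circ> fst \<in> hom (E \<times>\<times> A) S" by (auto simp: hom_def)
    ultimately show "q \<circ> fst \<in> epi (E \<times>\<times> A) S" by (simp add: epi_def)
    show "kernel (E \<times>\<times> A) S (q \<circ> fst) \<subseteq> group_center (E \<times>\<times> A)"
      using central_extension_kernel_commute[OF ce]
      by (auto simp: kernel_def group_center_def A.m_comm)
  qed
  have "(\<lambda>y. (y, \<one>\<^bsub>A\<^esub>)) \<in> hom E (E \<times>\<times> A)" "(\<lambda>y. (y, c y)) \<in> hom E (E \<times>\<times> A)"
    using c by (auto simp: hom_def)
  then have "(x, \<one>\<^bsub>A\<^esub>) = (x, c x)"
    using central_extension_lift_unique_any_type[OF u ceEA, of "\<lambda>y. (y, \<one>\<^bsub>A\<^esub>)" "\<lambda>y. (y, c y)" x] x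
    by simp
  then show ?thesis by simp
qed

lemma hom_to_central_extension_unique:
  assumes u: "universal_central_extension E q S" and ce: "central_extension F p G"
    and f: "f \<in> hom E F" and g: "g \<in> hom E F"
    and pfg: "\<And>x. x \<in> carrier E \<Longrightarrow> p (f x) = p (g x)" and x: "x \<in> carrier E"
  shows "f x = g x"
proof -
  interpret p: group_hom F G p by (rule central_extension_group_hom[OF ce])
  interpret q: group_hom E S q
    by (rule central_extension_group_hom[OF universal_central_extension_imp_central_extension[OF u]])
  interpret f: group_hom E F f by unfold_locales (rule f)
  interpret g: group_hom E F g by unfold_locales (rule g)
  define z where "z y = f y \<otimes>\<^bsub>F\<^esub> inv\<^bsub>F\<^esub> (g y)" for y
  let ?Z = "F\<lparr>carrier := kernel F G p\<rparr>"
  have zk: "z y \<in> kernel F G p" if "y \<in> carrier E" for y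
    using that by (simp add: kernel_def z_def pfg)
  have "z \<in> hom E ?Z"
  proof (rule homI)
    fix a b assume ab: "a \<in> carrier E" "b \<in> carrier E"
    then have zF: "z b \<in> carrier F" by (simp add: z_def)
    have "z (a \<otimes>\<^bsub>E\<^esub> b) = f a \<otimes>\<^bsub>F\<^esub> (z b \<otimes>\<^bsub>F\<^esub> inv\<^bsub>F\<^esub> (g a))"
      using ab by (simp add: z_def p.G.inv_mult_group p.G.m_assoc)
    also have "\<dots> = f a \<otimes>\<^bsub>F\<^esub> (inv\<^bsub>F\<^esub> (g a) \<otimes>\<^bsub>F\<^esub> z b)"
      using ab central_extension_kernel_commute[OF ce zk[of b], of "inv\<^bsub>F\<^esub> (g a)"] by simp
    also have "\<dots> = z a \<otimes>\<^bsub>F\<^esub> z b" using ab zF by (simp add: z_def[of a] p.G.m_assoc)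
    finally show "z (a \<otimes>\<^bsub>E\<^esub> b) = z a \<otimes>\<^bsub>?Z\<^esub> z b" by simp
  qed (simp add: zk)
  moreover have "comm_group ?Z"
  proof (rule group.group_comm_groupI)
    show "group ?Z" by (rule p.G.subgroup_imp_group[OF p.subgroup_kernel])
    show "a \<otimes>\<^bsub>?Z\<^esub> b = b \<otimes>\<^bsub>?Z\<^esub> a" if "a \<in> carrier ?Z" "b \<in> carrier ?Z" for a b
      using that central_extension_kernel_commute[OF ce, of b a] by (simp add: kernel_def)
  qed
  ultimately have "z x = \<one>\<^bsub>F\<^esub>" using hom_to_abelian_trivial[OF u _ _ x] by fastforce
  then show ?thesis
    using x by (metis f.hom_closed g.hom_closed p.G.inv_closed p.G.inv_equality p.G.inv_inv z_def)
qed

section \<open>Homomorphisms out of a universal central extension of a simple group\<close>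

text \<open>
  The image of \<open>ker h\<close> in \<open>S\<close> is normal. If it is all of \<open>S\<close>, then \<open>E\<close> is generated by \<open>ker h\<close> and
  the central subgroup \<open>ker q\<close>, so that \<open>h\<close> has abelian image and is trivial.
\<close>

lemma hom_trivial_or_kernel_subset:
  assumes u: "universal_central_extension E q S" and S: "simple_group S" and G: "group G"
    and h: "h \<in> hom E G"
  shows "(\<forall>x\<in>carrier E. h x = \<one>\<^bsub>G\<^esub>) \<or> kernel E G h \<subseteq> kernel E S q"
proof -
  note ce = universal_central_extension_imp_central_extension[OF u]
  interpret q: group_hom E S q by (rule central_extension_group_hom[OF ce])
  interpret G: group G by (rule G)
  interpret h: group_hom E G h by unfold_locales (rule h)
  have "q ` kernel E G h \<lhd> S"
    by (rule normal.surj_hom_normal_subgroup[OF h.normal_kernel q.group_hom_axioms])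
      (rule central_extension_group_hom(2)[OF ce])
  then consider (all) "q ` kernel E G h = carrier S" | (triv) "q ` kernel E G h = {\<one>\<^bsub>S\<^esub>}"
    using simple_group.no_real_normal_subgroup[OF S] by blast
  then show ?thesis
  proof cases
    case triv
    then show ?thesis by (auto simp: kernel_def)
  next
    case all
    have central: "\<exists>z\<in>kernel E S q. h z = h x" if x: "x \<in> carrier E" for x
    proof -
      have "q x \<in> q ` kernel E G h" using all x by simp
      then obtain n where n: "n \<in> carrier E" "h n = \<one>\<^bsub>G\<^esub>" "q n = q x"
        by (auto simp: kernel_def)
      then show ?thesis
        using x by (intro bexI[of _ "x \<otimes>\<^bsub>E\<^esub> inv\<^bsub>E\<^esub> n"]) (auto simp: kernel_def)
    qed
    let ?K = "G\<lparr>carrier := h ` carrier E\<rparr>"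
    have "comm_group ?K"
    proof (rule group.group_comm_groupI)
      show "group ?K" by (rule G.subgroup_imp_group[OF h.img_is_subgroup])
    next
      fix a b assume "a \<in> carrier ?K" "b \<in> carrier ?K"
      then obtain x y where xy: "x \<in> carrier E" "y \<in> carrier E" "a = h x" "b = h y" by auto
      obtain z where z: "z \<in> kernel E S q" "h z = h x" using central xy by blast
      then have "h (z \<otimes>\<^bsub>E\<^esub> y) = h (y \<otimes>\<^bsub>E\<^esub> z)"
        using central_extension_kernel_commute[OF ce z(1) xy(2)] by simp
      then show "a \<otimes>\<^bsub>?K\<^esub> b = b \<otimes>\<^bsub>?K\<^esub> a"
        using xy z by (simp add: kernel_def)
    qed
    moreover have "h \<in> hom E ?K" using h by (auto simp: hom_def)
    ultimately show ?thesis using hom_to_abelian_trivial[OF u] by fastforce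
  qed
qed

lemma kernel_subset_of_finite:
  assumes ce: "central_extension E q G" and fin: "finite (carrier G)"
    and h: "h \<in> hom E G" and ker: "kernel E G h \<subseteq> kernel E G q"
  shows "kernel E G q \<subseteq> kernel E G h"
proof
  interpret q: group_hom E G q by (rule central_extension_group_hom[OF ce])
  interpret h: group_hom E G h by unfold_locales (rule h)
  let ?K = "h ` carrier E"
  have gK: "group (G\<lparr>carrier := ?K\<rparr>)" by (rule q.H.subgroup_imp_group[OF h.img_is_subgroup])
  have "h \<in> epi E (G\<lparr>carrier := ?K\<rparr>)" using h by (auto simp: epi_def hom_def)
  moreover have "kernel E (G\<lparr>carrier := ?K\<rparr>) h \<subseteq> kernel E G q" using ker by (simp add: kernel_def)
  ultimately obtain r where r: "\<And>x. x \<in> carrier E \<Longrightarrow> r (h x) = q x"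
    using hom_factor_epi[OF q.G.is_group gK q.H.is_group _ q.homh] by metis
  have "r ` ?K = carrier G"
    using r central_extension_group_hom(2)[OF ce] by (auto simp: image_image)
  then have "inj_on r ?K"
    by (metis card_image_le card_mono eq_card_imp_inj_on fin finite_subset h.img_is_subgroup le_antisym
        subgroup.subset)
  moreover fix x assume "x \<in> kernel E G q"
  then have x: "x \<in> carrier E" "q x = q \<one>\<^bsub>E\<^esub>" by (simp_all add: kernel_def)
  then have "r (h x) = r (h \<one>\<^bsub>E\<^esub>)" using r[OF x(1)] r[OF q.G.one_closed] by simp
  ultimately have "h x = h \<one>\<^bsub>E\<^esub>" using x(1) q.G.one_closed by (blast dest: inj_onD)
  then show "x \<in> kernel E G h" using x(1) by (simp add: kernel_def)
qed

lemma kernel_subset_of_no_central_extension: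
  fixes G :: "'g monoid"
  assumes u: "universal_central_extension E q S" and G: "group G"
    and none: "\<not> (\<exists>K (F :: 'g monoid) p. subgroup K G \<and> central_extension F p S \<and>
                    \<not> split_extension F p S \<and> G\<lparr>carrier := K\<rparr> \<cong> F)"
    and h: "h \<in> hom E G" and ker: "kernel E G h \<subseteq> kernel E S q"
  shows "kernel E S q \<subseteq> kernel E G h"
proof
  note ce = universal_central_extension_imp_central_extension[OF u]
  interpret q: group_hom E S q by (rule central_extension_group_hom[OF ce])
  interpret G: group G by (rule G)
  interpret h: group_hom E G h by unfold_locales (rule h)
  let ?K = "G\<lparr>carrier := h ` carrier E\<rparr>"
  have gK: "group ?K" by (rule G.subgroup_imp_group[OF h.img_is_subgroup])
  have hK: "h \<in> hom E ?K" using h by (auto simp: hom_def)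
  have "h \<in> epi E ?K" using hK by (simp add: epi_def)
  moreover have "kernel E ?K h \<subseteq> kernel E S q" using ker by (simp add: kernel_def)
  ultimately obtain r where r: "r \<in> hom ?K S" "\<And>x. x \<in> carrier E \<Longrightarrow> r (h x) = q x"
    using hom_factor_epi[OF q.G.is_group gK q.H.is_group _ q.homh] by metis
  have ceK: "central_extension ?K r S"
    unfolding central_extension_def
  proof (intro conjI)
    show "r \<in> epi ?K S"
      using r central_extension_group_hom(2)[OF ce] by (auto simp: epi_def image_image)
    show "kernel ?K S r \<subseteq> group_center ?K"
    proof
      fix a assume "a \<in> kernel ?K S r"
      then obtain z where z: "z \<in> kernel E S q" "a = h z" using r(2) by (auto simp: kernel_def)
      have "h x \<otimes>\<^bsub>G\<^esub> h z = h z \<otimes>\<^bsub>G\<^esub> h x" if "x \<in> carrier E" for x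
      proof -
        have "z \<in> carrier E" using z by (simp add: kernel_def)
        then show ?thesis
          using that central_extension_kernel_commute[OF ce z(1) that] by (metis h.hom_mult)
      qed
      then show "a \<in> group_center ?K" using z by (auto simp: group_center_def kernel_def)
    qed
  qed (use gK q.H.is_group in auto)
  then have "split_extension ?K r S"
    using none h.img_is_subgroup iso_refl by blast
  then obtain s where s: "s \<in> hom S ?K" "\<And>y. y \<in> carrier S \<Longrightarrow> r (s y) = y"
    unfolding split_extension_def by blast
  have sq: "h x = s (q x)" if "x \<in> carrier E" for x
    using central_extension_lift_unique_any_type[OF u ceK hK _ hom_compose[OF q.homh s(1)] _ that]
      r(2) s(2) by simp
  fix x assume x: "x \<in> kernel E S q"
  then have "h x = s \<one>\<^bsub>S\<^esub>" using sq by (simp add: kernel_def)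
  also have "\<dots> = \<one>\<^bsub>G\<^esub>" using hom_one[OF s(1) q.H.is_group gK] by simp
  finally show "x \<in> kernel E G h" using x by (simp add: kernel_def)
qed

section \<open>Lifting homomorphisms to central extensions\<close>

lemma ex_lift_along_hom:
  assumes u: "universal_central_extension E q S" and ce: "central_extension F p G"
    and k: "k \<in> hom S G"
  shows "\<exists>f\<in>hom E F. \<forall>x\<in>carrier E. p (f x) = k (q x)"
proof -
  interpret q: group_hom E S q
    by (rule central_extension_group_hom[OF universal_central_extension_imp_central_extension[OF u]])
  interpret p: group_hom F G p by (rule central_extension_group_hom[OF ce])
  interpret k: group_hom S G k by unfold_locales (rule k)
  have p: "p ` carrier F = carrier G" by (rule central_extension_group_hom(2)[OF ce])
  define P where "P = {(s, y). s \<in> carrier S \<and> y \<in> carrier F \<and> k s = p y}"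
  interpret SF: group "S \<times>\<times> F" by (rule DirProd_group) unfold_locales
  have P: "subgroup P (S \<times>\<times> F)"
    by (rule SF.subgroupI)
      (auto simp: P_def inv_DirProd[OF q.H.is_group p.G.is_group] intro!: exI[of _ "\<one>\<^bsub>S\<^esub>"] exI[of _ "\<one>\<^bsub>F\<^esub>"])
  let ?P = "(S \<times>\<times> F)\<lparr>carrier := P\<rparr>"
  have "central_extension ?P fst S"
    unfolding central_extension_def
  proof (intro conjI)
    show "group ?P" by (rule SF.subgroup_imp_group[OF P])
    show "group S" by (rule q.H.is_group)
    have "s \<in> fst ` P" if "s \<in> carrier S" for s
    proof -
      have "k s \<in> p ` carrier F" using that p by simp
      then obtain y where "y \<in> carrier F" "k s = p y" by blast
      then have "(s, y) \<in> P" using that by (simp add: P_def)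
      then show ?thesis by force
    qed
    then show "fst \<in> epi ?P S" by (auto simp: epi_def hom_def P_def)
    show "kernel ?P S fst \<subseteq> group_center ?P"
      using central_extension_kernel_commute[OF ce]
      by (auto simp: kernel_def group_center_def P_def)
  qed
  then obtain f where f: "f \<in> hom E ?P" "\<forall>x\<in>carrier E. fst (f x) = q x"
    using central_extension_lift_any_type[OF u] by blast
  have fP: "f x \<in> P" if "x \<in> carrier E" for x using hom_in_carrier[OF f(1) that] by simp
  have "snd \<in> hom ?P F" by (auto simp: hom_def P_def)
  then have "snd \<circ> f \<in> hom E F" by (rule hom_compose[OF f(1)])
  moreover have "p (snd (f x)) = k (q x)" if "x \<in> carrier E" for x
    using fP[OF that] f(2) that by (auto simp: P_def)
  ultimately show ?thesis by (intro bexI[of _ "snd \<circ> f"]) auto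
qed

text \<open>
  The hypothesis \<open>collapse\<close> makes every homomorphism \<open>E \<rightarrow> G\<close> factor through \<open>q\<close>, by
  \<open>hom_trivial_or_kernel_subset\<close>; it is needed only for surjectivity of the bijection.
\<close>

lemma ex_bij_betw_Hom_lift:
  assumes u: "universal_central_extension E q S" and S: "simple_group S"
    and ce: "central_extension F p G"
    and collapse: "\<And>h. h \<in> hom E G \<Longrightarrow> kernel E G h \<subseteq> kernel E S q \<Longrightarrow>
                        kernel E S q \<subseteq> kernel E G h"
  obtains L where "bij_betw L (Hom S G) (Hom E F)"
    "\<And>k x. k \<in> Hom S G \<Longrightarrow> x \<in> carrier E \<Longrightarrow> p (L k x) = k (q x)"
proof -
  note ceE = universal_central_extension_imp_central_extension[OF u]
  interpret q: group_hom E S q by (rule central_extension_group_hom[OF ceE])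
  interpret p: group_hom F G p by (rule central_extension_group_hom[OF ce])
  have surj: "q ` carrier E = carrier S" by (rule central_extension_group_hom(2)[OF ceE])
  have "\<exists>f. f \<in> Hom E F \<and> (\<forall>x\<in>carrier E. p (f x) = k (q x))" if k: "k \<in> Hom S G" for k
  proof -
    obtain f where "f \<in> hom E F" "\<forall>x\<in>carrier E. p (f x) = k (q x)"
      using ex_lift_along_hom[OF u ce] k by (auto simp: Hom_def)
    then show ?thesis
      by (intro exI[of _ "restrict f (carrier E)"]) (auto simp: Hom_def hom_def)
  qed
  then obtain L where L: "\<And>k. k \<in> Hom S G \<Longrightarrow> L k \<in> Hom E F"
    "\<And>k x. k \<in> Hom S G \<Longrightarrow> x \<in> carrier E \<Longrightarrow> p (L k x) = k (q x)"
    by metis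
  have "inj_on L (Hom S G)"
  proof (rule inj_onI)
    fix k l assume kl: "k \<in> Hom S G" "l \<in> Hom S G" "L k = L l"
    show "k = l"
    proof (rule extensionalityI[of _ "carrier S"])
      fix y assume "y \<in> carrier S"
      then obtain x where "x \<in> carrier E" "y = q x" using surj by blast
      then show "k y = l y" using kl L(2) by metis
    qed (use kl in \<open>auto simp: Hom_def\<close>)
  qed
  moreover have "f \<in> L ` Hom S G" if f: "f \<in> Hom E F" for f
  proof -
    have fh: "f \<in> hom E F" using f by (simp add: Hom_def)
    have pf: "p \<circ> f \<in> hom E G" using fh p.homh by (rule hom_compose)
    have ker: "kernel E S q \<subseteq> kernel E G (p \<circ> f)"
      using hom_trivial_or_kernel_subset[OF u S p.H.is_group pf] collapse[OF pf]
      by (auto simp: kernel_def)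
    have "q \<in> epi E S" using surj q.homh by (simp add: epi_def)
    then obtain k0 where k0: "k0 \<in> hom S G" "\<And>x. x \<in> carrier E \<Longrightarrow> k0 (q x) = (p \<circ> f) x"
      using hom_factor_epi[OF q.G.is_group q.H.is_group p.H.is_group _ pf ker] by metis
    define k where "k = restrict k0 (carrier S)"
    have k: "k \<in> Hom S G" using k0(1) by (auto simp: k_def Hom_def hom_def)
    have "f = L k"
    proof (rule extensionalityI[of _ "carrier E"])
      fix x assume x: "x \<in> carrier E"
      show "f x = L k x"
      proof (rule hom_to_central_extension_unique[OF u ce fh _ _ x])
        show "L k \<in> hom E F" using L(1)[OF k] by (simp add: Hom_def)
        show "p (f y) = p (L k y)" if "y \<in> carrier E" for y
          using that L(2)[OF k] k0(2) by (simp add: k_def)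
      qed
    qed (use f L(1)[OF k] in \<open>auto simp: Hom_def\<close>)
    then show ?thesis using k by blast
  qed
  ultimately have "bij_betw L (Hom S G) (Hom E F)" using L(1) by (auto simp: bij_betw_def)
  then show thesis using L(2) that by blast
qed

section \<open>Localizations and universal central extensions\<close>

theorem theorem1p5:
  fixes H :: "'h monoid" and G :: "'g monoid"
    and Ht :: "'ht monoid" and Gt :: "'gt monoid"
    and i :: "'h \<Rightarrow> 'g" and j :: "'ht \<Rightarrow> 'gt"
    and q\<^sub>H :: "'ht \<Rightarrow> 'h" and q\<^sub>G :: "'gt \<Rightarrow> 'g"
  assumes "simple_group H" and "finite (carrier H)" and "\<not> comm_group H"
    and "simple_group G" and "finite (carrier G)" and "\<not> comm_group G"
    and "i \<in> mon H G"
    and "universal_central_extension Ht q\<^sub>H H"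
    and "universal_central_extension Gt q\<^sub>G G"
    and "j \<in> hom Ht Gt" and "\<forall>x\<in>carrier Ht. q\<^sub>G (j x) = i (q\<^sub>H x)"
    and "\<not> (\<exists>K (E :: 'g monoid) q. subgroup K G \<and> central_extension E q H \<and>
              \<not> split_extension E q H \<and> G\<lparr>carrier := K\<rparr> \<cong> E)"
  shows "localization H G i \<longleftrightarrow> localization Ht Gt j"
proof -
  note ceH = universal_central_extension_imp_central_extension[OF assms(8)]
  note ceG = universal_central_extension_imp_central_extension[OF assms(9)]
  interpret qH: group_hom Ht H q\<^sub>H by (rule central_extension_group_hom[OF ceH])
  interpret qG: group_hom Gt G q\<^sub>G by (rule central_extension_group_hom[OF ceG])
  have i: "i \<in> hom H G" using assms(7) by (simp add: mon_def)
  have j: "j \<in> hom Ht Gt" by (rule assms(10))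
  obtain L\<^sub>H where LH: "bij_betw L\<^sub>H (Hom H G) (Hom Ht Gt)"
    "\<And>k x. k \<in> Hom H G \<Longrightarrow> x \<in> carrier Ht \<Longrightarrow> q\<^sub>G (L\<^sub>H k x) = k (q\<^sub>H x)"
    using ex_bij_betw_Hom_lift[OF assms(8) assms(1) ceG]
      kernel_subset_of_no_central_extension[OF assms(8) qG.H.is_group assms(12)] by metis
  obtain L\<^sub>G where LG: "bij_betw L\<^sub>G (Hom G G) (Hom Gt Gt)"
    "\<And>k x. k \<in> Hom G G \<Longrightarrow> x \<in> carrier Gt \<Longrightarrow> q\<^sub>G (L\<^sub>G k x) = k (q\<^sub>G x)"
    using ex_bij_betw_Hom_lift[OF assms(9) assms(4) ceG]
      kernel_subset_of_finite[OF ceG assms(5)] by metis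
  define ci where "ci = (\<lambda>f :: 'g \<Rightarrow> 'g. compose (carrier H) f i)"
  define cj where "cj = (\<lambda>f :: 'gt \<Rightarrow> 'gt. compose (carrier Ht) f j)"
  have ciH: "ci ` Hom G G \<subseteq> Hom H G" unfolding ci_def using compose_in_Hom[OF qH.H.is_group i] by blast
  have square: "(cj \<circ> L\<^sub>G) k = (L\<^sub>H \<circ> ci) k" if k: "k \<in> Hom G G" for k
  proof -
    have L: "L\<^sub>G k \<in> Hom Gt Gt" using LG(1) k by (auto simp: bij_betw_def)
    have cjL: "cj (L\<^sub>G k) \<in> Hom Ht Gt" unfolding cj_def by (rule compose_in_Hom[OF qH.G.is_group j L])
    have cik: "ci k \<in> Hom H G" using ciH k by blast
    then have Lc: "L\<^sub>H (ci k) \<in> Hom Ht Gt" using LH(1) by (auto simp: bij_betw_def)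
    have "cj (L\<^sub>G k) = L\<^sub>H (ci k)"
    proof (rule extensionalityI[of _ "carrier Ht"])
      fix x assume x: "x \<in> carrier Ht"
      show "cj (L\<^sub>G k) x = L\<^sub>H (ci k) x"
      proof (rule hom_to_central_extension_unique[OF assms(8) ceG _ _ _ x])
        fix y assume y: "y \<in> carrier Ht"
        have "q\<^sub>G (cj (L\<^sub>G k) y) = k (q\<^sub>G (j y))"
          using y LG(2)[OF k] hom_in_carrier[OF j y] by (simp add: cj_def compose_eq)
        also have "\<dots> = q\<^sub>G (L\<^sub>H (ci k) y)"
          using y LH(2)[OF cik y] assms(11) by (simp add: ci_def compose_eq)
        finally show "q\<^sub>G (cj (L\<^sub>G k) y) = q\<^sub>G (L\<^sub>H (ci k) y)" .
      qed (use cjL Lc in \<open>auto simp: Hom_def\<close>)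
    qed (use cjL Lc in \<open>auto simp: Hom_def\<close>)
    then show ?thesis by simp
  qed
  have "localization H G i \<longleftrightarrow> bij_betw ci (Hom G G) (Hom H G)"
    using i by (simp add: localization_def ci_def)
  also have "\<dots> \<longleftrightarrow> bij_betw (L\<^sub>H \<circ> ci) (Hom G G) (Hom Ht Gt)"
    by (rule bij_betw_comp_iff2[OF LH(1) ciH])
  also have "\<dots> \<longleftrightarrow> bij_betw (cj \<circ> L\<^sub>G) (Hom G G) (Hom Ht Gt)"
    using square by (intro bij_betw_cong) simp
  also have "\<dots> \<longleftrightarrow> bij_betw cj (Hom Gt Gt) (Hom Ht Gt)"
    by (rule bij_betw_comp_iff[OF LG(1), symmetric])
  also have "\<dots> \<longleftrightarrow> localization Ht Gt j"
    using j by (simp add: localization_def cj_def)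
  finally show ?thesis .
qed

end
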